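(* Let $0<a<b$ be real numbers. Then for all $x\in[a,b]$, $$(b-a)\left\{\frac{1}{H(a,b)}-\frac{1}{L(a,b)}\right\}\ge (x-a)\left\{\frac{1}{H(a,x)}-\frac{1}{L(a,x)}\right\}.$$
   Context: For positive reals $u,v$, $H(u,v)=\frac{2uv}{u+v}$ is the harmonic mean, and for $u\neq v$, $L(u,v)=\frac{v-u}{\log v-\log u}$ is the logarithmic mean, with the usual convention $L(u,u)=u$. *)

theory Defs
  imports Complex_Main
begin

(* Both means are intended for positive arguments only; their values elsewhere are junk. *)

definition harmonic_mean :: "real \<Rightarrow> real \<Rightarrow> real" where
  "harmonic_mean u v = 2 * u * v / (u + v)"

definition logarithmic_mean :: "real \<Rightarrow> real \<Rightarrow> real" where
  "logarithmic_mean u v = (if u = v then u else (v - u) / (ln v - ln u))"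

end

theory Submission
  imports Defs
begin

text \<open>
  Multiplying by \<open>x - a\<close> clears the denominator of the logarithmic mean, so the right-hand
  side is the elementary function \<open>x / (2 * a) - a / (2 * x) - (ln x - ln a)\<close> of \<open>x\<close>
  (also at \<open>x = a\<close>, where both expressions vanish). Its derivative
  \<open>1 / (2 * a) + a / (2 * x\<^sup>2) - 1 / x\<close> is the perfect square
  \<open>(x - a)\<^sup>2 / (2 * a * x\<^sup>2)\<close>, so the function increases on the positive reals, and
  the theorem compares its values at \<open>x\<close> and \<open>b\<close>.
\<close>

lemma scaled_inverse_mean_gap_eq:
  fixes a x :: real
  assumes "0 < a" and "0 < x"
  shows "(x - a) * (1 / harmonic_mean a x - 1 / logarithmic_mean a x)
    = x / (2 * a) - a / (2 * x) - (ln x - ln a)"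
proof (cases "x = a")
  case True
  then show ?thesis using assms by simp
next
  case False
  have harmonic: "(x - a) * (1 / harmonic_mean a x) = x / (2 * a) - a / (2 * x)"
    using assms by (simp add: harmonic_mean_def field_simps)
  have logarithmic: "(x - a) * (1 / logarithmic_mean a x) = ln x - ln a"
    using False by (simp add: logarithmic_mean_def)
  show ?thesis
    unfolding right_diff_distrib harmonic logarithmic ..
qed

lemma scaled_inverse_mean_gap_mono:
  fixes a x y :: real
  assumes "0 < a" and "0 < x" and "x \<le> y"
  shows "x / (2 * a) - a / (2 * x) - (ln x - ln a) \<le> y / (2 * a) - a / (2 * y) - (ln y - ln a)"
proof (rule DERIV_nonneg_imp_nondecreasing[OF \<open>x \<le> y\<close>])
  fix t :: real
  assume "x \<le> t"
  with assms have t: "0 < t" by simp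
  have "((\<lambda>t. t / (2 * a) - a / (2 * t) - (ln t - ln a))
      has_real_derivative (t - a)\<^sup>2 / (2 * a * t\<^sup>2)) (at t)"
    using \<open>0 < a\<close> t
    by (auto intro!: derivative_eq_intros simp: field_simps power2_eq_square)
  moreover have "0 \<le> (t - a)\<^sup>2 / (2 * a * t\<^sup>2)"
    using \<open>0 < a\<close> by simp
  ultimately show "\<exists>d. ((\<lambda>t. t / (2 * a) - a / (2 * t) - (ln t - ln a))
      has_real_derivative d) (at t) \<and> 0 \<le> d"
    by blast
qed

theorem mainTheorem7:
  fixes a b :: real
  assumes "0 < a" and "a < b"
  shows "\<forall>x\<in>{a..b}.
    (b - a) * (1 / harmonic_mean a b - 1 / logarithmic_mean a b)
      \<ge> (x - a) * (1 / harmonic_mean a x - 1 / logarithmic_mean a x)"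
proof
  fix x
  assume "x \<in> {a..b}"
  with assms have "0 < x" "x \<le> b" "0 < b" by auto
  then show "(b - a) * (1 / harmonic_mean a b - 1 / logarithmic_mean a b)
      \<ge> (x - a) * (1 / harmonic_mean a x - 1 / logarithmic_mean a x)"
    using \<open>0 < a\<close> by (simp only: scaled_inverse_mean_gap_eq scaled_inverse_mean_gap_mono)
qed

end
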